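(* Let $\Xi$ be a repetitive one-sided subshift over a finite alphabet which has exactly one right special word of each length $n\ge 1$. Let $(\delta_n)_{n\ge 0}$ be a strictly decreasing sequence of positive reals converging to $0$ for which there are constants $\underline{c},\overline{c}>0$ with $\underline{c}\,\delta_n\le \delta_{2n}$ and $\delta_{nm}\le \overline{c}\,\delta_n\delta_m$ for all $n,m\ge 1$. Equip $\Xi$ with the metric $d$ defined by $(\delta_n)_n$ and let $\overline{d}_s=\sup_\tau d_s^\tau$ be the supremum of the spectral distances over all choice functions $\tau$. Then the following are equivalent: (1) the subshift is repulsive; (2) $\overline{d}_s$ is Lipschitz equivalent to $d$.
   Context: Subshifts. Let $\mathcal A$ be a finite alphabet. A one-sided subshift $\Xi\subset\mathcal A^{\mathbb N}$ is the (closed, shift invariant) set of all one-sided infinite sequences $\xi=\xi_1\xi_2\xi_3\cdots$ whose finite subwords all belong to a given collection of words; its language $\mathcal L$ is the set of all finite words (including the empty one) occurring in elements of $\Xi$. $|w|$ is the length of $w$. A word $w\in\mathcal L$ is right special if $wa,wb\in\mathcal L$ for two distinct letters $a,b$. The subshift is repetitive if for each $n$ there is $N$ such that every word of $\mathcal L$ of length $N$ contains every word of $\mathcal L$ of length $n$. It is repulsive if $$\ell=\inf\Big\{\tfrac{|W|-|w|}{|w|}: w,W\in\mathcal L,\ |w|\ge1,\ w\neq W,\ w \text{ is both a prefix and a suffix of } W\Big\}>0 .$$ Metric. For $\xi\ne\eta$ in $\Xi$, $d(\xi,\eta)=\delta_n$ where $n$ is the length of the longest common prefix of $\xi$ and $\eta$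 (that is, $d(\xi,\eta)=\inf\{\delta_n:\xi_m=\eta_m\ \forall m\le n\}$), and $d(\xi,\xi)=0$. Choice functions. A choice function $\tau$ is given by choosing, for each $w\in\mathcal L$, a letter $a_w$ with $wa_w\in\mathcal L$; $\tau(w)\in\Xi$ is the infinite sequence obtained from $w$ by recursively appending the chosen letters. Spectral distance. Let $E$ be the set of ordered pairs $e=(u,v)$ of distinct words of $\mathcal L$ of equal length $n+1\ge1$ having the same prefix of length $n$; the length of such an edge is $l(e)=\delta_n$. On $\ell^2(E)$ let $\pi_\tau(f)\psi(u,v)=f(\tau(u))\psi(u,v)$ for $f\in C(\Xi)$, and $D\psi(u,v)=l(u,v)^{-1}\psi(v,u)$. The spectral distance is $d_s^\tau(x,y)=\sup\{|f(x)-f(y)|: f\in C(\Xi),\ \|[D,\pi_\tau(f)]\|\le 1\}\in[0,\infty]$; the condition $\|[D,\pi_\tau(f)]\|\le1$ means $|f(\tau(u))-f(\tau(v))|\le l(u,v)$ for all $(u,v)\in E$. $\overline d_s$ is Lipschitz equivalent to $d$ if there is $c>0$ with $c^{-1}d\le \overline d_s\le c\,d$. *)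

theory Defs
  imports "HOL-Analysis.Analysis" "HOL-Library.Sublist"
begin

text \<open>
  The alphabet is a finite type \<open>'a\<close>. Sequences are indexed from \<open>0\<close>, so the letter
  \<open>\<xi>\<^sub>1\<close> of a sequence is \<open>\<xi> 0\<close>, and the prefix of length \<open>n\<close> consists of
  \<open>\<xi> 0, \<dots>, \<xi> (n - 1)\<close>.
\<close>

section \<open>Subshifts\<close>

definition subword :: "(nat \<Rightarrow> 'a) \<Rightarrow> nat \<Rightarrow> nat \<Rightarrow> 'a list" where
  "subword \<xi> i n = map \<xi> [i..<i + n]"

definition is_subshift :: "(nat \<Rightarrow> 'a::finite) set \<Rightarrow> bool" where
  "is_subshift \<Xi> \<longleftrightarrow> (\<exists>F. \<Xi> = {\<xi>. \<forall>i n. subword \<xi> i n \<in> F})"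

definition language :: "(nat \<Rightarrow> 'a) set \<Rightarrow> 'a list set" where
  "language \<Xi> = {subword \<xi> i n |\<xi> i n. \<xi> \<in> \<Xi>}"

definition right_special :: "(nat \<Rightarrow> 'a) set \<Rightarrow> 'a list \<Rightarrow> bool" where
  "right_special \<Xi> w \<longleftrightarrow> w \<in> language \<Xi> \<and>
     (\<exists>a b. a \<noteq> b \<and> w @ [a] \<in> language \<Xi> \<and> w @ [b] \<in> language \<Xi>)"

definition repetitive :: "(nat \<Rightarrow> 'a) set \<Rightarrow> bool" where
  "repetitive \<Xi> \<longleftrightarrow> (\<forall>n. \<exists>N. \<forall>W\<in>language \<Xi>. \<forall>w\<in>language \<Xi>.
     length W = N \<longrightarrow> length w = n \<longrightarrow> sublist w W)"

text \<open>The infimum is taken in the extended reals, so that the infimum of the empty set is \<open>\<infinity>\<close>.\<close>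

definition repulsion_index :: "(nat \<Rightarrow> 'a) set \<Rightarrow> ereal" where
  "repulsion_index \<Xi> =
     Inf {ereal ((real (length W) - real (length w)) / real (length w)) | w W.
            w \<in> language \<Xi> \<and> W \<in> language \<Xi> \<and> length w \<ge> 1 \<and> w \<noteq> W \<and>
            prefix w W \<and> suffix w W}"

definition repulsive :: "(nat \<Rightarrow> 'a) set \<Rightarrow> bool" where
  "repulsive \<Xi> \<longleftrightarrow> repulsion_index \<Xi> > 0"

section \<open>Metric and continuous functions\<close>

definition shift_dist :: "(nat \<Rightarrow> real) \<Rightarrow> (nat \<Rightarrow> 'a) \<Rightarrow> (nat \<Rightarrow> 'a) \<Rightarrow> real" where
  "shift_dist \<delta> \<xi> \<eta> = (if \<xi> = \<eta> then 0 else \<delta> (GREATEST n. subword \<xi> 0 n = subword \<eta> 0 n))"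

text \<open>
  The topology on a subshift is the one inherited from the product of the discrete topologies;
  it is also the topology induced by \<^const>\<open>shift_dist\<close> when \<open>\<delta>\<close> is strictly decreasing with limit \<open>0\<close>.
\<close>

definition continuous_functions :: "(nat \<Rightarrow> 'a) set \<Rightarrow> ((nat \<Rightarrow> 'a) \<Rightarrow> complex) set" where
  "continuous_functions \<Xi> =
     {f. continuous_map
           (subtopology (product_topology (\<lambda>_. discrete_topology UNIV) UNIV) \<Xi>) euclidean f}"

section \<open>Choice functions\<close>

definition choice_letters :: "(nat \<Rightarrow> 'a) set \<Rightarrow> ('a list \<Rightarrow> 'a) set" where
  "choice_letters \<Xi> = {a. \<forall>w\<in>language \<Xi>. w @ [a w] \<in> language \<Xi>}"

text \<open>
  \<open>Suc i\<close> appended letters make the word long enough for its letter at position \<open>i\<close> to exist;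
  further appending does not change it.
\<close>

definition choice_ext :: "('a list \<Rightarrow> 'a) \<Rightarrow> 'a list \<Rightarrow> (nat \<Rightarrow> 'a)" where
  "choice_ext a w = (\<lambda>i. (((\<lambda>u. u @ [a u]) ^^ Suc i) w) ! i)"

definition choice_functions :: "(nat \<Rightarrow> 'a) set \<Rightarrow> ('a list \<Rightarrow> (nat \<Rightarrow> 'a)) set" where
  "choice_functions \<Xi> = choice_ext ` choice_letters \<Xi>"

section \<open>Spectral distance\<close>

definition ell2 :: "'e set \<Rightarrow> ('e \<Rightarrow> complex) set" where
  "ell2 E = {\<psi>. (\<lambda>e. (cmod (\<psi> e))\<^sup>2) summable_on E}"

definition ell2_norm :: "'e set \<Rightarrow> ('e \<Rightarrow> complex) \<Rightarrow> real" where
  "ell2_norm E \<psi> = sqrt (\<Sum>\<^sub>\<infinity>e\<in>E. (cmod (\<psi> e))\<^sup>2)"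

text \<open>
  Norm in \<open>[0,\<infinity>]\<close> of an operator on \<open>\<ell>\<^sup>2(E)\<close> with domain \<open>M\<close>. Membership of \<open>T \<psi>\<close> in
  \<open>\<ell>\<^sup>2(E)\<close> is demanded explicitly because divergent sums have the value \<open>0\<close>.
\<close>

definition op_norm ::
    "'e set \<Rightarrow> ('e \<Rightarrow> complex) set \<Rightarrow> (('e \<Rightarrow> complex) \<Rightarrow> ('e \<Rightarrow> complex)) \<Rightarrow> ennreal" where
  "op_norm E M T = Inf {ennreal C | C. C \<ge> 0 \<and>
     (\<forall>\<psi>\<in>M. T \<psi> \<in> ell2 E \<and> ell2_norm E (T \<psi>) \<le> C * ell2_norm E \<psi>)}"

definition edges :: "(nat \<Rightarrow> 'a) set \<Rightarrow> ('a list \<times> 'a list) set" where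
  "edges \<Xi> = {(u, v). u \<in> language \<Xi> \<and> v \<in> language \<Xi> \<and> u \<noteq> v \<and>
     (\<exists>n. length u = n + 1 \<and> length v = n + 1 \<and> take n u = take n v)}"

definition edge_length :: "(nat \<Rightarrow> real) \<Rightarrow> 'a list \<times> 'a list \<Rightarrow> real" where
  "edge_length \<delta> e = \<delta> (length (fst e) - 1)"

definition represent ::
    "('a list \<Rightarrow> (nat \<Rightarrow> 'a)) \<Rightarrow> ((nat \<Rightarrow> 'a) \<Rightarrow> complex) \<Rightarrow>
     ('a list \<times> 'a list \<Rightarrow> complex) \<Rightarrow> ('a list \<times> 'a list \<Rightarrow> complex)" where
  "represent \<tau> f \<psi> = (\<lambda>(u, v). f (\<tau> u) * \<psi> (u, v))"

definition dirac ::
    "(nat \<Rightarrow> real) \<Rightarrow> ('a list \<times> 'a list \<Rightarrow> complex) \<Rightarrow> ('a list \<times> 'a list \<Rightarrow> complex)" where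
  "dirac \<delta> \<psi> = (\<lambda>(u, v). complex_of_real (inverse (edge_length \<delta> (u, v))) * \<psi> (v, u))"

definition dirac_domain ::
    "(nat \<Rightarrow> 'a) set \<Rightarrow> (nat \<Rightarrow> real) \<Rightarrow> ('a list \<times> 'a list \<Rightarrow> complex) set" where
  "dirac_domain \<Xi> \<delta> = {\<psi> \<in> ell2 (edges \<Xi>). dirac \<delta> \<psi> \<in> ell2 (edges \<Xi>)}"

definition commutator ::
    "(nat \<Rightarrow> real) \<Rightarrow> ('a list \<Rightarrow> (nat \<Rightarrow> 'a)) \<Rightarrow> ((nat \<Rightarrow> 'a) \<Rightarrow> complex) \<Rightarrow>
     ('a list \<times> 'a list \<Rightarrow> complex) \<Rightarrow> ('a list \<times> 'a list \<Rightarrow> complex)" where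
  "commutator \<delta> \<tau> f \<psi> = (\<lambda>e. dirac \<delta> (represent \<tau> f \<psi>) e - represent \<tau> f (dirac \<delta> \<psi>) e)"

definition spectral_dist ::
    "(nat \<Rightarrow> 'a) set \<Rightarrow> (nat \<Rightarrow> real) \<Rightarrow> ('a list \<Rightarrow> (nat \<Rightarrow> 'a)) \<Rightarrow>
     (nat \<Rightarrow> 'a) \<Rightarrow> (nat \<Rightarrow> 'a) \<Rightarrow> ennreal" where
  "spectral_dist \<Xi> \<delta> \<tau> x y =
     (SUP f \<in> {f \<in> continuous_functions \<Xi>.
                 op_norm (edges \<Xi>) (dirac_domain \<Xi> \<delta>) (commutator \<delta> \<tau> f) \<le> 1}.
        ennreal (cmod (f x - f y)))"

definition upper_spectral_dist ::
    "(nat \<Rightarrow> 'a) set \<Rightarrow> (nat \<Rightarrow> real) \<Rightarrow> (nat \<Rightarrow> 'a) \<Rightarrow> (nat \<Rightarrow> 'a) \<Rightarrow> ennreal" where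
  "upper_spectral_dist \<Xi> \<delta> x y = (SUP \<tau> \<in> choice_functions \<Xi>. spectral_dist \<Xi> \<delta> \<tau> x y)"

definition lipschitz_equivalent ::
    "'x set \<Rightarrow> ('x \<Rightarrow> 'x \<Rightarrow> ennreal) \<Rightarrow> ('x \<Rightarrow> 'x \<Rightarrow> real) \<Rightarrow> bool" where
  "lipschitz_equivalent X D d \<longleftrightarrow>
     (\<exists>c>0. \<forall>x\<in>X. \<forall>y\<in>X. ennreal (inverse c * d x y) \<le> D x y \<and> D x y \<le> ennreal (c * d x y))"

section \<open>The commutator condition in pointwise form\<close>

lemma edges_swap: "(u, v) \<in> edges \<Xi> \<longleftrightarrow> (v, u) \<in> edges \<Xi>"
  unfolding edges_def by auto

lemma edge_length_swap: "(u, v) \<in> edges \<Xi> \<Longrightarrow> edge_length \<delta> (v, u) = edge_length \<delta> (u, v)"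
  unfolding edges_def edge_length_def by auto

lemma commutator_apply:
  "commutator \<delta> \<tau> f \<psi> (u, v) =
     complex_of_real (inverse (edge_length \<delta> (u, v))) * (f (\<tau> v) - f (\<tau> u)) * \<psi> (v, u)"
  by (simp add: commutator_def dirac_def represent_def algebra_simps)

lemma op_norm_commutator_le_1_iff:
  fixes \<Xi> :: "(nat \<Rightarrow> 'a) set"
  assumes pos: "\<And>n. \<delta> n > 0"
  shows "op_norm (edges \<Xi>) (dirac_domain \<Xi> \<delta>) (commutator \<delta> \<tau> f) \<le> 1 \<longleftrightarrow>
    (\<forall>(u, v)\<in>edges \<Xi>. cmod (f (\<tau> u) - f (\<tau> v)) \<le> edge_length \<delta> (u, v))"
    (is "?L \<longleftrightarrow> ?R")
proof
  have lpos: "edge_length \<delta> e > 0" for e :: "'a list \<times> 'a list"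
    by (simp add: edge_length_def pos)
  {
    assume L: ?L
    show ?R
    proof (clarify)
      fix u v assume e: "(u, v) \<in> edges \<Xi>"
      then have e': "(v, u) \<in> edges \<Xi>" using edges_swap by blast
      define \<psi> :: "'a list \<times> 'a list \<Rightarrow> complex" where "\<psi> = (\<lambda>e. if e = (v, u) then 1 else 0)"
      define k where "k = cmod (f (\<tau> u) - f (\<tau> v)) / edge_length \<delta> (u, v)"
      have nrm: "ell2_norm (edges \<Xi>) g = cmod (g x)" and mem: "g \<in> ell2 (edges \<Xi>)"
        if "x \<in> edges \<Xi>" "\<And>y. y \<noteq> x \<Longrightarrow> g y = 0"
        for g :: "'a list \<times> 'a list \<Rightarrow> complex" and x
      proof -
        have "((\<lambda>e. (cmod (g e))\<^sup>2) has_sum (\<Sum>e\<in>{x}. (cmod (g e))\<^sup>2)) (edges \<Xi>)"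
          by (rule has_sum_finite_neutralI[where B = "{x}"]) (use that in auto)
        then have h: "((\<lambda>e. (cmod (g e))\<^sup>2) has_sum (cmod (g x))\<^sup>2) (edges \<Xi>)" by simp
        show "ell2_norm (edges \<Xi>) g = cmod (g x)"
          unfolding ell2_norm_def infsumI[OF h] by simp
        show "g \<in> ell2 (edges \<Xi>)"
          unfolding ell2_def using h by (auto simp: summable_on_def)
      qed
      have p: "\<psi> \<in> ell2 (edges \<Xi>)" "ell2_norm (edges \<Xi>) \<psi> = 1"
        using nrm[OF e', of \<psi>] mem[OF e', of \<psi>] by (auto simp: \<psi>_def)
      have "dirac \<delta> \<psi> \<in> ell2 (edges \<Xi>)"
        by (rule mem[OF e]) (auto simp: dirac_def \<psi>_def split: if_splits)
      with p have dom: "\<psi> \<in> dirac_domain \<Xi> \<delta>" by (simp add: dirac_domain_def)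
      have "ell2_norm (edges \<Xi>) (commutator \<delta> \<tau> f \<psi>) = cmod (commutator \<delta> \<tau> f \<psi> (u, v))"
        by (rule nrm[OF e]) (auto simp: commutator_apply \<psi>_def split: if_splits)
      also have "\<dots> = k"
        using lpos[of "(u, v)"]
        by (simp add: commutator_apply \<psi>_def k_def norm_mult norm_inverse norm_minus_commute divide_inverse)
      finally have k: "ell2_norm (edges \<Xi>) (commutator \<delta> \<tau> f \<psi>) = k" .
      have "ennreal k \<le> op_norm (edges \<Xi>) (dirac_domain \<Xi> \<delta>) (commutator \<delta> \<tau> f)"
        unfolding op_norm_def
      proof (rule Inf_greatest, clarify)
        fix C :: real
        assume "\<forall>\<psi>\<in>dirac_domain \<Xi> \<delta>. commutator \<delta> \<tau> f \<psi> \<in> ell2 (edges \<Xi>) \<and>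
          ell2_norm (edges \<Xi>) (commutator \<delta> \<tau> f \<psi>) \<le> C * ell2_norm (edges \<Xi>) \<psi>"
        from this[rule_format, OF dom] k p show "ennreal k \<le> ennreal C"
          by (simp add: ennreal_leI)
      qed
      with L have "ennreal k \<le> 1" by (rule order_trans[rotated])
      then have "k \<le> 1" by simp
      then show "cmod (f (\<tau> u) - f (\<tau> v)) \<le> edge_length \<delta> (u, v)"
        unfolding k_def using lpos[of "(u, v)"] by (simp add: field_simps)
    qed
  }
  {
    assume R: ?R
    have "commutator \<delta> \<tau> f \<psi> \<in> ell2 (edges \<Xi>) \<and>
      ell2_norm (edges \<Xi>) (commutator \<delta> \<tau> f \<psi>) \<le> 1 * ell2_norm (edges \<Xi>) \<psi>"
      if dom: "\<psi> \<in> dirac_domain \<Xi> \<delta>" for \<psi>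
    proof -
      have s: "(\<lambda>e. (cmod (\<psi> e))\<^sup>2) summable_on edges \<Xi>"
        using dom by (simp add: dirac_domain_def ell2_def)
      have inj: "inj_on prod.swap (edges \<Xi>)" by simp
      have im: "prod.swap ` edges \<Xi> = edges \<Xi>"
        using edges_swap[of _ _ \<Xi>] by (force simp: image_iff)
      have s': "(\<lambda>e. (cmod (\<psi> (prod.swap e)))\<^sup>2) summable_on edges \<Xi>"
        using summable_on_reindex[OF inj, of "\<lambda>e. (cmod (\<psi> e))\<^sup>2"] s im by (simp add: o_def)
      have i': "(\<Sum>\<^sub>\<infinity>e\<in>edges \<Xi>. (cmod (\<psi> (prod.swap e)))\<^sup>2) = (\<Sum>\<^sub>\<infinity>e\<in>edges \<Xi>. (cmod (\<psi> e))\<^sup>2)"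
        using infsum_reindex[OF inj, of "\<lambda>e. (cmod (\<psi> e))\<^sup>2"] im by (simp add: o_def)
      have le: "(cmod (commutator \<delta> \<tau> f \<psi> e))\<^sup>2 \<le> (cmod (\<psi> (prod.swap e)))\<^sup>2" if e: "e \<in> edges \<Xi>" for e
      proof -
        obtain u v where [simp]: "e = (u, v)" by (cases e)
        have "cmod (f (\<tau> v) - f (\<tau> u)) \<le> edge_length \<delta> (u, v)"
          using R e by (auto simp: norm_minus_commute)
        then have "inverse (edge_length \<delta> (u, v)) * cmod (f (\<tau> v) - f (\<tau> u)) \<le> 1"
          using lpos[of "(u, v)"] by (simp add: field_simps)
        then have "inverse (edge_length \<delta> (u, v)) * cmod (f (\<tau> v) - f (\<tau> u)) * cmod (\<psi> (v, u))
            \<le> 1 * cmod (\<psi> (v, u))"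
          by (rule mult_right_mono) simp
        then have "cmod (commutator \<delta> \<tau> f \<psi> e) \<le> cmod (\<psi> (prod.swap e))"
          using lpos[of "(u, v)"] by (simp add: commutator_apply norm_mult norm_inverse)
        then show ?thesis by (rule power_mono) simp
      qed
      have s'': "(\<lambda>e. (cmod (commutator \<delta> \<tau> f \<psi> e))\<^sup>2) summable_on edges \<Xi>"
        by (rule summable_on_comparison_test[OF s']) (use le in auto)
      have "(\<Sum>\<^sub>\<infinity>e\<in>edges \<Xi>. (cmod (commutator \<delta> \<tau> f \<psi> e))\<^sup>2)
          \<le> (\<Sum>\<^sub>\<infinity>e\<in>edges \<Xi>. (cmod (\<psi> (prod.swap e)))\<^sup>2)"
        by (rule infsum_mono[OF s'' s' le])
      with s'' i' show ?thesis by (simp add: ell2_def ell2_norm_def)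
    qed
    then have "op_norm (edges \<Xi>) (dirac_domain \<Xi> \<delta>) (commutator \<delta> \<tau> f) \<le> ennreal 1"
      unfolding op_norm_def by (intro Inf_lower CollectI exI[of _ 1]) auto
    then show ?L by simp
  }
qed

end

theory Submission
  imports Defs
begin

text \<open>
  Let \<open>\<xi>\<close> and \<open>\<eta>\<close> have the longest common prefix of length \<open>k\<close>, and let \<open>S(\<xi>)\<close> be the sum of
  \<open>\<delta>\<^sub>n\<close> over those \<open>n \<ge> k\<close> for which the prefix of length \<open>n\<close> of \<open>\<xi>\<close> is right special.
  Along \<open>\<xi>\<close> a function of commutator norm at most \<open>1\<close> can only vary at right special prefixes,
  which bounds the upper spectral distance by \<open>S(\<xi>) + S(\<eta>)\<close>; a choice function that leaves \<open>\<xi>\<close>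
  at every right special prefix shows that it is at least \<open>S(\<xi>)\<close>. Lipschitz equivalence therefore
  means \<open>S(\<xi>) \<le> C \<delta>\<^sub>k\<close>. Repulsiveness makes the lengths of the right special prefixes grow
  geometrically, and submultiplicativity of \<open>\<delta>\<close> turns \<open>S(\<xi>)\<close> into a geometric series. Without
  repulsiveness there are words with arbitrarily many periods, and a maximal one yields \<open>j + 1\<close>
  right special prefixes with lengths between \<open>k\<close> and \<open>2 k\<close>, so that
  \<open>S(\<xi>) \<ge> (j + 1) \<delta>\<^bsub>2k\<^esub> \<ge> c\<^sub>1 (j + 1) \<delta>\<^sub>k\<close>.
\<close>

section \<open>Words and languages\<close>

lemma length_subword [simp]: "length (subword \<xi> i n) = n"
  by (simp add: subword_def)

lemma nth_subword [simp]: "j < n \<Longrightarrow> subword \<xi> i n ! j = \<xi> (i + j)"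
  by (simp add: subword_def)

lemma subword_Suc: "subword \<xi> i (Suc n) = subword \<xi> i n @ [\<xi> (i + n)]"
  by (simp add: subword_def)

lemma take_subword: "m \<le> n \<Longrightarrow> take m (subword \<xi> i n) = subword \<xi> i m"
  by (rule nth_equalityI) auto

lemma subword_eq_iff: "subword \<xi> 0 n = subword \<eta> 0 n \<longleftrightarrow> (\<forall>i<n. \<xi> i = \<eta> i)"
  by (auto simp: list_eq_iff_nth_eq)

lemma subword_in_language: "\<xi> \<in> \<Xi> \<Longrightarrow> subword \<xi> i n \<in> language \<Xi>"
  by (auto simp: language_def)

lemma subword_infix:
  assumes "subword \<xi> i n = xs @ v @ ys"
  shows "v = subword \<xi> (i + length xs) (length v)"
proof (rule nth_equalityI)
  fix j assume j: "j < length v"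
  have "n = length xs + length v + length ys"
    using arg_cong[OF assms, of length] by simp
  then have "subword \<xi> i n ! (length xs + j) = \<xi> (i + (length xs + j))"
    using j by (intro nth_subword) simp
  then show "v ! j = subword \<xi> (i + length xs) (length v) ! j"
    using assms j by (simp add: nth_append add.assoc)
qed simp

lemma language_infix:
  assumes "xs @ v @ ys \<in> language \<Xi>"
  shows "v \<in> language \<Xi>"
proof -
  obtain \<xi> i n where "\<xi> \<in> \<Xi>" and "subword \<xi> i n = xs @ v @ ys"
    using assms by (auto simp: language_def)
  then show ?thesis
    using subword_infix subword_in_language by metis
qed

text \<open>Both one-letter extensions survive the removal of letters on the left, since
  \<open>language\<close> is closed under factors.\<close>

lemma right_special_suffix:
  assumes "right_special \<Xi> w" and "suffix v w"
  shows "right_special \<Xi> v"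
proof -
  obtain xs where w: "w = xs @ v" using assms(2) by (auto simp: suffix_def)
  have *: "v @ s \<in> language \<Xi>" if "w @ s \<in> language \<Xi>" for s
    using language_infix[of xs "v @ s" "[]"] that by (simp add: w)
  then show ?thesis
    using assms(1) *[of "[]"] unfolding right_special_def by auto
qed

text \<open>This is closedness: a subshift is cut out by conditions on finite words, and the factor
  of length \<open>n\<close> at position \<open>i\<close> already lies in the prefix of length
  \<open>i + n\<close>.\<close>

lemma in_subshiftI:
  assumes "is_subshift \<Xi>" and "\<And>n. subword \<xi> 0 n \<in> language \<Xi>"
  shows "\<xi> \<in> \<Xi>"
proof -
  obtain F where F: "\<Xi> = {\<xi>. \<forall>i n. subword \<xi> i n \<in> F}"
    using assms(1) by (auto simp: is_subshift_def)
  have "subword \<xi> i n \<in> F" for i n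
  proof -
    have "subword \<xi> 0 (i + n) = subword \<xi> 0 i @ subword \<xi> i n @ []"
      by (rule nth_equalityI) (auto simp: nth_append)
    then have "subword \<xi> i n \<in> language \<Xi>"
      using assms(2) language_infix by metis
    then show ?thesis by (auto simp: language_def F)
  qed
  then show ?thesis by (simp add: F)
qed

text \<open>By shift invariance, deleting the letters before an occurrence of \<open>w\<close>
  leaves a sequence of the subshift that starts with \<open>w\<close>.\<close>

lemma language_prefixE:
  assumes "is_subshift \<Xi>" and "w \<in> language \<Xi>"
  obtains \<xi> where "\<xi> \<in> \<Xi>" and "subword \<xi> 0 (length w) = w"
proof -
  obtain \<eta> i n where \<eta>: "\<eta> \<in> \<Xi>" "w = subword \<eta> i n"
    using assms(2) by (auto simp: language_def)
  have sw: "subword (\<lambda>j. \<eta> (i + j)) 0 m = subword \<eta> i m" for m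
    by (rule nth_equalityI) auto
  show thesis
  proof (rule that)
    show "(\<lambda>j. \<eta> (i + j)) \<in> \<Xi>"
      using assms(1) by (rule in_subshiftI) (simp add: sw subword_in_language \<eta>)
    show "subword (\<lambda>j. \<eta> (i + j)) 0 (length w) = w"
      by (simp add: sw \<eta>)
  qed
qed

lemma language_extend:
  assumes "is_subshift \<Xi>" and "w \<in> language \<Xi>"
  obtains c where "w @ [c] \<in> language \<Xi>"
proof -
  obtain \<xi> where "\<xi> \<in> \<Xi>" "subword \<xi> 0 (length w) = w"
    using language_prefixE[OF assms] .
  then show thesis
    using that[of "\<xi> (length w)"] subword_in_language[of \<xi> \<Xi> 0 "Suc (length w)"]
    by (simp add: subword_Suc)
qed

section \<open>The metric and the first position of disagreement\<close>

lemma shift_dist_neq: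
  assumes "\<xi> \<noteq> \<eta>"
  obtains k where "shift_dist \<delta> \<xi> \<eta> = \<delta> k" and "\<And>i. i < k \<Longrightarrow> \<xi> i = \<eta> i" and "\<xi> k \<noteq> \<eta> k"
proof -
  define k where "k = (LEAST k. \<xi> k \<noteq> \<eta> k)"
  have ne: "\<exists>k. \<xi> k \<noteq> \<eta> k" using assms by auto
  have k: "\<xi> k \<noteq> \<eta> k" unfolding k_def using ne by (rule LeastI_ex)
  have ag: "\<xi> i = \<eta> i" if "i < k" for i
    using not_less_Least that unfolding k_def by blast
  have "(GREATEST n. subword \<xi> 0 n = subword \<eta> 0 n) = k"
    by (rule Greatest_equality) (use k ag in \<open>auto simp: subword_eq_iff not_less[symmetric]\<close>)
  then show thesis
    using that[of k] k ag assms by (simp add: shift_dist_def)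
qed

lemma shift_dist_eq:
  assumes "\<And>i. i < k \<Longrightarrow> \<xi> i = \<eta> i" and "\<xi> k \<noteq> \<eta> k"
  shows "shift_dist \<delta> \<xi> \<eta> = \<delta> k"
proof -
  have "\<xi> \<noteq> \<eta>" using assms(2) by auto
  then obtain k' where k': "shift_dist \<delta> \<xi> \<eta> = \<delta> k'" "\<And>i. i < k' \<Longrightarrow> \<xi> i = \<eta> i" "\<xi> k' \<noteq> \<eta> k'"
    using shift_dist_neq by metis
  then have "k' = k" using assms by (metis linorder_neqE_nat)
  then show ?thesis using k' by simp
qed

section \<open>Choice functions\<close>

lemma funpow_append_prefix:
  "prefix (((\<lambda>u. u @ [a u]) ^^ m) w) (((\<lambda>u. u @ [a u]) ^^ (m + n)) w)"
  by (induction n) (auto intro: prefix_order.trans)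

lemma length_funpow_append: "length (((\<lambda>u. u @ [a u]) ^^ m) w) = length w + m"
  by (induction m) auto

text \<open>The iterates are prefixes of one another, so every number of steps that reaches position
  \<open>i\<close> yields the same letter as the \<open>Suc i\<close> steps of the
  definition.\<close>

lemma choice_ext_nth:
  assumes "i < length w + m"
  shows "choice_ext a w i = (((\<lambda>u. u @ [a u]) ^^ m) w) ! i"
proof -
  let ?e = "\<lambda>m. ((\<lambda>u. u @ [a u]) ^^ m) w"
  have *: "?e m ! i = ?e m' ! i" if "m \<le> m'" "i < length w + m" for m m'
  proof -
    obtain n where "m' = m + n" using \<open>m \<le> m'\<close> le_Suc_ex by blast
    then obtain zs where "?e m' = ?e m @ zs"
      using funpow_append_prefix[of m a w n] by (auto simp: prefix_def)
    then show ?thesis using that by (simp add: nth_append length_funpow_append)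
  qed
  have "?e m ! i = ?e (max m (Suc i)) ! i" "?e (Suc i) ! i = ?e (max m (Suc i)) ! i"
    using assms by (intro *; simp)+
  then show ?thesis by (simp add: choice_ext_def)
qed

lemma subword_choice_ext:
  "subword (choice_ext a w) 0 (length w + m) = ((\<lambda>u. u @ [a u]) ^^ m) w"
  by (rule nth_equalityI) (simp_all add: length_funpow_append choice_ext_nth)

lemma choice_ext_less: "i < length w \<Longrightarrow> choice_ext a w i = w ! i"
  using choice_ext_nth[of i w 0 a] by simp

lemma choice_ext_ge:
  assumes "length w \<le> m"
  shows "choice_ext a w m = a (subword (choice_ext a w) 0 m)"
proof -
  obtain n where m: "m = length w + n" using assms le_Suc_ex by blast
  have "subword (choice_ext a w) 0 (Suc m) = subword (choice_ext a w) 0 m @ [a (subword (choice_ext a w) 0 m)]"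
    using subword_choice_ext[of a w "Suc n"] subword_choice_ext[of a w n] by (simp add: m)
  then show ?thesis by (simp add: subword_Suc)
qed

text \<open>Appending the chosen letter is the first step of the recursion. Hence
  \<open>\<tau>\<close> changes along the prefixes of a sequence only where the sequence departs
  from the choice.\<close>

lemma choice_ext_snoc: "choice_ext a (w @ [a w]) = choice_ext a w"
proof
  fix i
  have "((\<lambda>u. u @ [a u]) ^^ i) (w @ [a w]) = ((\<lambda>u. u @ [a u]) ^^ Suc i) w"
    by (simp add: funpow_Suc_right del: funpow.simps)
  then show "choice_ext a (w @ [a w]) i = choice_ext a w i"
    using choice_ext_nth[of i "w @ [a w]" i a] choice_ext_nth[of i w "Suc i" a] by simp
qed

lemma choice_ext_in_subshift:
  assumes "is_subshift \<Xi>" and "a \<in> choice_letters \<Xi>" and "w \<in> language \<Xi>"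
  shows "choice_ext a w \<in> \<Xi>"
  using assms(1)
proof (rule in_subshiftI)
  fix n
  have "((\<lambda>u. u @ [a u]) ^^ m) w \<in> language \<Xi>" for m
    by (induction m) (use assms in \<open>auto simp: choice_letters_def\<close>)
  then have "subword (choice_ext a w) 0 (length w + n) \<in> language \<Xi>"
    by (simp add: subword_choice_ext)
  moreover have "take n (subword (choice_ext a w) 0 (length w + n)) = subword (choice_ext a w) 0 n"
    by (simp add: take_subword)
  ultimately show "subword (choice_ext a w) 0 n \<in> language \<Xi>"
    using language_infix[of "[]"] by (metis append_Nil append_take_drop_id)
qed

section \<open>The spectral distance as a sum over right special prefixes\<close>

text \<open>Zero weights off the right special prefixes turn sums over intervals of lengths into
  partial sums of \<open>S(\<xi>)\<close>. Both estimates need only partial sums, so convergence is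
  never an issue.\<close>

definition special_weight :: "(nat \<Rightarrow> 'a) set \<Rightarrow> (nat \<Rightarrow> real) \<Rightarrow> (nat \<Rightarrow> 'a) \<Rightarrow> nat \<Rightarrow> real" where
  "special_weight \<Xi> \<delta> \<xi> n = (if right_special \<Xi> (subword \<xi> 0 n) then \<delta> n else 0)"

text \<open>Each coordinate of \<open>x n\<close> is eventually constant, which is convergence in
  the product of discrete spaces.\<close>

lemma continuous_functions_limit:
  assumes "f \<in> continuous_functions \<Xi>" and "\<xi> \<in> \<Xi>" and "\<And>n. x n \<in> \<Xi>"
    and agree: "\<And>n i. i < n \<Longrightarrow> x n i = \<xi> i"
  shows "(\<lambda>n. f (x n)) \<longlonglongrightarrow> f \<xi>"
proof -
  have "eventually (\<lambda>n. x n i = \<xi> i) sequentially" for i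
    using eventually_gt_at_top[of i] by eventually_elim (rule agree)
  then have "limitin (discrete_topology UNIV) (\<lambda>n. x n i) (\<xi> i) sequentially" for i
    unfolding limitin_def by (auto intro: eventually_mono[of "\<lambda>n. x n i = \<xi> i"])
  then have "limitin (subtopology (product_topology (\<lambda>_. discrete_topology UNIV) UNIV) \<Xi>) x \<xi> sequentially"
    using assms(2,3) by (simp add: limitin_subtopology limitin_componentwise)
  then have "limitin euclidean (f \<circ> x) (f \<xi>) sequentially"
    using assms(1) unfolding continuous_functions_def by (blast intro: continuous_map_limit)
  then show ?thesis by (simp add: o_def)
qed

text \<open>The product is the indicator of the cylinder of the prefix of length
  \<open>n + 1\<close>; in this form continuity reduces to single discrete coordinates.\<close>

lemma continuous_functions_cylinder_sum:
  "(\<lambda>\<zeta>. \<Sum>n\<le>N. g n * (\<Prod>i\<le>n. if \<zeta> i = \<xi> i then 1 else 0)) \<in> continuous_functions \<Xi>"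
proof -
  let ?T = "product_topology (\<lambda>_. discrete_topology UNIV) UNIV :: (nat \<Rightarrow> 'a) topology"
  have "continuous_map ?T euclidean (\<lambda>\<zeta>. if \<zeta> i = \<xi> i then 1 else 0 :: complex)" for i
  proof -
    have "continuous_map ?T (discrete_topology UNIV) (\<lambda>\<zeta>. \<zeta> i)"
      by (rule continuous_map_product_projection) simp
    moreover have "continuous_map (discrete_topology UNIV) euclidean (\<lambda>c. if c = \<xi> i then 1 else 0 :: complex)"
      by simp
    ultimately have "continuous_map ?T euclidean ((\<lambda>c. if c = \<xi> i then 1 else 0 :: complex) \<circ> (\<lambda>\<zeta>. \<zeta> i))"
      by (rule continuous_map_compose)
    then show ?thesis by (simp add: o_def)
  qed
  then have "continuous_map ?T euclidean (\<lambda>\<zeta>. \<Sum>n\<le>N. g n * (\<Prod>i\<le>n. if \<zeta> i = \<xi> i then 1 else 0))"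
    by (auto simp: continuous_map_atin intro!: tendsto_sum tendsto_mult tendsto_const tendsto_prod)
  then show ?thesis
    by (simp add: continuous_functions_def continuous_map_from_subtopology)
qed

text \<open>
  The witnessing choice function leaves \<open>\<xi>\<close> at every right special prefix of \<open>\<xi>\<close>. For a test
  function that adds the weight \<open>n\<close> on the cylinder of the prefix of length \<open>n + 1\<close> this has
  the effect that the two ends of an edge of length \<open>n\<close> differ in the \<open>n\<close>-th summand only.
\<close>

lemma upper_spectral_dist_ge:
  fixes \<Xi> :: "(nat \<Rightarrow> 'a::finite) set"
  assumes sub: "is_subshift \<Xi>" and pos: "\<And>n. \<delta> n > 0" and "\<xi> \<in> \<Xi>"
    and agree: "\<And>i. i < k \<Longrightarrow> \<xi> i = \<eta> i" and neq: "\<xi> k \<noteq> \<eta> k"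
  shows "ennreal (\<Sum>n=k..N. special_weight \<Xi> \<delta> \<xi> n) \<le> upper_spectral_dist \<Xi> \<delta> \<xi> \<eta>"
proof -
  define W where "W = special_weight \<Xi> \<delta> \<xi>"
  have W0: "W n \<ge> 0" and W1: "W n \<le> \<delta> n" for n
    using pos[of n] by (auto simp: W_def special_weight_def)
  have "\<exists>c. w @ [c] \<in> language \<Xi> \<and>
      (right_special \<Xi> w \<longrightarrow> w = subword \<xi> 0 (length w) \<longrightarrow> c \<noteq> \<xi> (length w))"
    if "w \<in> language \<Xi>" for w
  proof (cases "right_special \<Xi> w")
    case True
    then show ?thesis unfolding right_special_def by metis
  next
    case False
    then show ?thesis using language_extend[OF sub that] by metis
  qed
  then obtain a where a: "\<And>w. w \<in> language \<Xi> \<Longrightarrow> w @ [a w] \<in> language \<Xi> \<and>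
      (right_special \<Xi> w \<longrightarrow> w = subword \<xi> 0 (length w) \<longrightarrow> a w \<noteq> \<xi> (length w))"
    by metis
  define \<tau> where "\<tau> = choice_ext a"
  have "\<tau> \<in> choice_functions \<Xi>"
    using a by (auto simp: \<tau>_def choice_functions_def choice_letters_def)
  define f :: "(nat \<Rightarrow> 'a) \<Rightarrow> complex" where
    "f \<zeta> = (\<Sum>n\<le>N. of_real (W n) * (\<Prod>i\<le>n. if \<zeta> i = \<xi> i then 1 else 0))" for \<zeta>
  have f_cont: "f \<in> continuous_functions \<Xi>"
    unfolding f_def[abs_def] by (rule continuous_functions_cylinder_sum)
  have f_eq: "f \<zeta> = (\<Sum>n\<le>N. if \<forall>i\<le>n. \<zeta> i = \<xi> i then of_real (W n) else 0)" for \<zeta>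
    unfolding f_def by (rule sum.cong) (auto intro: prod.neutral)
  have "cmod (f (\<tau> u) - f (\<tau> v)) \<le> edge_length \<delta> (u, v)" if e: "(u, v) \<in> edges \<Xi>" for u v
  proof -
    obtain n where n: "length u = Suc n" "length v = Suc n" "take n u = take n v"
      "u \<in> language \<Xi>" "v \<in> language \<Xi>"
      using e by (auto simp: edges_def)
    let ?t = "\<lambda>\<zeta> m. if \<forall>i\<le>m. \<zeta> i = \<xi> i then of_real (W m) else 0 :: complex"
    \<comment> \<open>Either the weight at \<open>m\<close> is zero, or agreement with
      \<open>\<xi>\<close> below \<open>m\<close> puts \<open>\<tau> w\<close> at a right special
      prefix of \<open>\<xi>\<close>, where the choice leaves \<open>\<xi>\<close>.\<close>
    have high: "?t (\<tau> w) m = 0" if "m > n" "length w = Suc n" "w \<in> language \<Xi>" for w m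
    proof (cases "right_special \<Xi> (subword \<xi> 0 m) \<and> (\<forall>i<m. \<tau> w i = \<xi> i)")
      case True
      then have "subword (\<tau> w) 0 m = subword \<xi> 0 m"
        by (simp add: subword_eq_iff)
      then have "\<tau> w m = a (subword \<xi> 0 m)"
        using choice_ext_ge[of w m a] that by (simp add: \<tau>_def)
      moreover have "a (subword \<xi> 0 m) \<noteq> \<xi> m"
        using a[of "subword \<xi> 0 m"] True subword_in_language[OF \<open>\<xi> \<in> \<Xi>\<close>] by simp
      ultimately show ?thesis by auto
    qed (auto simp: W_def special_weight_def)
    have low: "?t (\<tau> u) m = ?t (\<tau> v) m" if "m < n" for m
    proof -
      have "\<tau> u i = \<tau> v i" if "i \<le> m" for i
      proof -
        have "i < n" using that \<open>m < n\<close> by simp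
        then have "u ! i = v ! i" using n(3) by (metis nth_take)
        then show ?thesis using \<open>i < n\<close> n(1,2) by (simp add: \<tau>_def choice_ext_less)
      qed
      then show ?thesis by simp
    qed
    have "f (\<tau> u) - f (\<tau> v) = (\<Sum>m\<le>N. ?t (\<tau> u) m - ?t (\<tau> v) m)"
      by (simp add: f_eq sum_subtractf)
    also have "\<dots> = (\<Sum>m\<le>N. if m = n then ?t (\<tau> u) n - ?t (\<tau> v) n else 0)"
    proof (rule sum.cong)
      fix m
      show "?t (\<tau> u) m - ?t (\<tau> v) m = (if m = n then ?t (\<tau> u) n - ?t (\<tau> v) n else 0)"
        using high[of m u] high[of m v] low[of m] n by (cases m n rule: linorder_cases) auto
    qed simp
    also have "\<dots> = (if n \<le> N then ?t (\<tau> u) n - ?t (\<tau> v) n else 0)"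
      by (simp add: sum.delta)
    \<comment> \<open>Both terms are \<open>0\<close> or \<open>W n\<close>, so their difference is
      at most \<open>W n\<close> in modulus, not twice that.\<close>
    also have "cmod \<dots> \<le> \<delta> n"
      using W0[of n] W1[of n] pos[of n] by (auto simp: less_imp_le)
    finally show ?thesis using n by (simp add: edge_length_def)
  qed
  then have "op_norm (edges \<Xi>) (dirac_domain \<Xi> \<delta>) (commutator \<delta> \<tau> f) \<le> 1"
    using op_norm_commutator_le_1_iff[of \<delta> \<Xi> \<tau> f] pos by auto
  with f_cont have "ennreal (cmod (f \<xi> - f \<eta>)) \<le> spectral_dist \<Xi> \<delta> \<tau> \<xi> \<eta>"
    unfolding spectral_dist_def by (intro SUP_upper) simp
  also have "\<dots> \<le> upper_spectral_dist \<Xi> \<delta> \<xi> \<eta>"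
    unfolding upper_spectral_dist_def using \<open>\<tau> \<in> choice_functions \<Xi>\<close> by (rule SUP_upper)
  finally have "ennreal (cmod (f \<xi> - f \<eta>)) \<le> upper_spectral_dist \<Xi> \<delta> \<xi> \<eta>" .
  \<comment> \<open>The summands below \<open>k\<close> cancel; from \<open>k\<close> on,
    \<open>\<eta>\<close> is outside the cylinders and only the weights of \<open>\<xi>\<close>
    remain.\<close>
  moreover have "f \<xi> - f \<eta> = of_real (\<Sum>n=k..N. W n)"
  proof -
    have "f \<xi> - f \<eta> = (\<Sum>n\<le>N. if k \<le> n then of_real (W n) else 0)"
      unfolding f_eq sum_subtractf[symmetric]
    proof (rule sum.cong)
      fix n
      have "(\<forall>i\<le>n. \<eta> i = \<xi> i) \<longleftrightarrow> \<not> k \<le> n"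
        using agree neq by (metis le_less_trans not_le order_refl)
      then show "(if \<forall>i\<le>n. \<xi> i = \<xi> i then complex_of_real (W n) else 0)
          - (if \<forall>i\<le>n. \<eta> i = \<xi> i then of_real (W n) else 0) = (if k \<le> n then of_real (W n) else 0)"
        by simp
    qed simp
    also have "\<dots> = (\<Sum>n\<in>{..N} \<inter> {n. k \<le> n}. of_real (W n))"
      by (simp add: sum.inter_restrict)
    also have "{..N} \<inter> {n. k \<le> n} = {k..N}" by auto
    finally show ?thesis by simp
  qed
  moreover have "(\<Sum>n=k..N. W n) \<ge> 0" by (intro sum_nonneg W0)
  ultimately show ?thesis by (simp only: norm_of_real abs_of_nonneg W_def)
qed

text \<open>The common prefix of length \<open>k\<close> gives one reference point for both
  sequences. From its image under \<open>\<tau>\<close>, each sequence is reached by lengthening the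
  prefix letter by letter, and the increments of \<open>f\<close> telescope.\<close>

lemma upper_spectral_dist_le:
  fixes \<Xi> :: "(nat \<Rightarrow> 'a::finite) set"
  assumes sub: "is_subshift \<Xi>" and pos: "\<And>n. \<delta> n > 0" and "\<xi> \<in> \<Xi>" "\<eta> \<in> \<Xi>"
    and agree: "\<And>i. i < k \<Longrightarrow> \<xi> i = \<eta> i"
    and S: "\<And>N. (\<Sum>n=k..<N. special_weight \<Xi> \<delta> \<xi> n) \<le> S"
    and S': "\<And>N. (\<Sum>n=k..<N. special_weight \<Xi> \<delta> \<eta> n) \<le> S'"
  shows "upper_spectral_dist \<Xi> \<delta> \<xi> \<eta> \<le> ennreal (S + S')"
  unfolding upper_spectral_dist_def spectral_dist_def
proof (intro SUP_least ennreal_leI)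
  fix \<tau> f
  assume "\<tau> \<in> choice_functions \<Xi>"
  then obtain a where a: "a \<in> choice_letters \<Xi>" and \<tau>: "\<tau> = choice_ext a"
    by (auto simp: choice_functions_def)
  assume "f \<in> {f \<in> continuous_functions \<Xi>.
    op_norm (edges \<Xi>) (dirac_domain \<Xi> \<delta>) (commutator \<delta> \<tau> f) \<le> 1}"
  then have f: "f \<in> continuous_functions \<Xi>"
    and edge: "\<And>u v. (u, v) \<in> edges \<Xi> \<Longrightarrow> cmod (f (\<tau> u) - f (\<tau> v)) \<le> edge_length \<delta> (u, v)"
    using op_norm_commutator_le_1_iff[of \<delta> \<Xi> \<tau> f] pos by auto
  have bound: "cmod (f (\<tau> (subword \<zeta> 0 k)) - f \<zeta>) \<le> s"
    if "\<zeta> \<in> \<Xi>" and s: "\<And>N. (\<Sum>n=k..<N. special_weight \<Xi> \<delta> \<zeta> n) \<le> s" for \<zeta> s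
  proof -
    let ?g = "\<lambda>n. f (\<tau> (subword \<zeta> 0 n))"
    note L = subword_in_language[OF \<open>\<zeta> \<in> \<Xi>\<close>]
    \<comment> \<open>A chosen letter leaves \<open>\<tau>\<close> unchanged. Any other letter
      forms, with the chosen one, an edge of length \<open>\<delta> n\<close>, and the prefix is
      then right special.\<close>
    have step: "cmod (?g n - ?g (Suc n)) \<le> special_weight \<Xi> \<delta> \<zeta> n" for n
    proof (cases "\<zeta> n = a (subword \<zeta> 0 n)")
      case True
      then have "?g (Suc n) = ?g n"
        by (simp add: subword_Suc \<tau> choice_ext_snoc)
      then show ?thesis using pos[of n] by (simp add: special_weight_def less_imp_le)
    next
      case False
      let ?w = "subword \<zeta> 0 n"
      have 1: "?w @ [a ?w] \<in> language \<Xi>" using a L by (simp add: choice_letters_def)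
      have 2: "?w @ [\<zeta> n] \<in> language \<Xi>" using L[of 0 "Suc n"] by (simp add: subword_Suc)
      have "right_special \<Xi> ?w"
        unfolding right_special_def using 1 2 False L by metis
      moreover have "(?w @ [a ?w], ?w @ [\<zeta> n]) \<in> edges \<Xi>"
        using 1 2 False by (auto simp: edges_def)
      from edge[OF this] have "cmod (?g n - ?g (Suc n)) \<le> \<delta> n"
        by (simp add: \<tau> choice_ext_snoc edge_length_def subword_Suc)
      ultimately show ?thesis by (simp add: special_weight_def)
    qed
    have tele: "cmod (?g k - ?g N) \<le> s" if "N \<ge> k" for N
    proof -
      have "?g k - ?g N = (\<Sum>n=k..<N. ?g n - ?g (Suc n))"
        using sum_Suc_diff'[OF that, of "\<lambda>n. - ?g n"] by (simp add: algebra_simps)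
      also have "cmod \<dots> \<le> (\<Sum>n=k..<N. special_weight \<Xi> \<delta> \<zeta> n)"
        by (intro sum_norm_le step)
      finally show ?thesis using s[of N] by linarith
    qed
    have "?g \<longlonglongrightarrow> f \<zeta>"
    proof (rule continuous_functions_limit[OF f \<open>\<zeta> \<in> \<Xi>\<close>])
      show "\<tau> (subword \<zeta> 0 n) \<in> \<Xi>" for n
        using choice_ext_in_subshift[OF sub a L] by (simp add: \<tau>)
      show "\<tau> (subword \<zeta> 0 n) i = \<zeta> i" if "i < n" for n i
        using that by (simp add: \<tau> choice_ext_less)
    qed
    then have "(\<lambda>N. cmod (?g k - ?g N)) \<longlonglongrightarrow> cmod (?g k - f \<zeta>)"
      by (intro tendsto_intros)
    then show ?thesis
      by (rule LIMSEQ_le_const2) (use tele in blast)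
  qed
  have "subword \<xi> 0 k = subword \<eta> 0 k" using agree by (simp add: subword_eq_iff)
  then have "f \<xi> - f \<eta> = (f (\<tau> (subword \<eta> 0 k)) - f \<eta>) - (f (\<tau> (subword \<xi> 0 k)) - f \<xi>)"
    by simp
  then show "cmod (f \<xi> - f \<eta>) \<le> S + S'"
    using bound[OF \<open>\<xi> \<in> \<Xi>\<close> S] bound[OF \<open>\<eta> \<in> \<Xi>\<close> S'] norm_triangle_ineq4 by (smt (verit))
qed

section \<open>Repulsive subshifts\<close>

text \<open>The index may be infinite, so a real number strictly between \<open>0\<close> and the
  index is taken.\<close>

lemma repulsiveE:
  assumes "repulsive \<Xi>"
  obtains l :: real where "l > 0"
    and "\<And>w W. \<lbrakk>w \<in> language \<Xi>; W \<in> language \<Xi>; length w \<ge> 1; w \<noteq> W; prefix w W; suffix w W\<rbrakk>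
      \<Longrightarrow> (1 + l) * length w \<le> length W"
proof -
  obtain l where l: "0 < ereal l" "ereal l < repulsion_index \<Xi>"
    using assms ereal_dense2 unfolding repulsive_def zero_ereal_def by blast
  show thesis
  proof (rule that[of l])
    show "l > 0" using l by simp
    fix w W
    assume w: "w \<in> language \<Xi>" "W \<in> language \<Xi>" "length w \<ge> 1" "w \<noteq> W" "prefix w W" "suffix w W"
    then have "repulsion_index \<Xi> \<le> ereal ((real (length W) - real (length w)) / real (length w))"
      unfolding repulsion_index_def by (intro Inf_lower) auto
    with l have "ereal l < ereal ((real (length W) - real (length w)) / real (length w))"
      by (meson less_le_trans)
    then have "l < (real (length W) - real (length w)) / real (length w)" by simp
    moreover have "real (length w) > 0" using w(3) by linarith
    ultimately show "(1 + l) * length w \<le> length W" by (simp add: pos_less_divide_eq algebra_simps)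
  qed
qed

section \<open>Sums over sets of lengths with geometric gaps\<close>

lemma lacunary_card:
  fixes B :: "nat set" and q :: real
  assumes "finite B" and q: "q > 1" and k: "\<And>n. n \<in> B \<Longrightarrow> k \<le> n"
    and gap: "\<And>n m. \<lbrakk>n \<in> B; m \<in> B; n < m\<rbrakk> \<Longrightarrow> q * n \<le> m"
    and bound: "\<And>n. n \<in> B \<Longrightarrow> n < q ^ p * k"
  shows "card B \<le> p"
  using assms(1) k gap bound
proof (induction p arbitrary: B)
  case 0
  then have "B = {}" by force
  then show ?case by simp
next
  case (Suc p)
  show ?case
  proof (cases "B = {}")
    case False
    let ?M = "Max B"
    have M: "?M \<in> B" using Suc.prems(1) False by simp
    have lt: "n < ?M" if "n \<in> B - {?M}" for n
      using that Suc.prems(1) by (simp add: order.not_eq_order_implies_strict)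
    \<comment> \<open>The remaining elements are at most \<open>?M / q\<close>, so removing the
      maximum costs one power of \<open>q\<close> in the bound.\<close>
    have "card (B - {?M}) \<le> p"
    proof (rule Suc.IH)
      fix n assume n: "n \<in> B - {?M}"
      have "q * n \<le> ?M" using Suc.prems(3) n M lt by blast
      also have "?M < q ^ Suc p * k" using Suc.prems(4) M by blast
      finally have "q * n < q * (q ^ p * k)" by (simp add: mult.assoc)
      then show "n < q ^ p * k" using q by (simp add: mult_less_cancel_left_pos)
    qed (use Suc.prems in auto)
    then show ?thesis using Suc.prems(1) M by (simp add: card_Diff_singleton)
  qed simp
qed

text \<open>Split at \<open>M * k\<close>. Below it lie at most \<open>p\<close> elements, each
  contributing at most \<open>\<delta> k\<close>; above it, induction starts from
  \<open>\<delta> (M * k) \<le> \<delta> k / 2\<close>. The factor \<open>2 * p\<close> solves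
  \<open>C = p + C / 2\<close>.\<close>

lemma lacunary_sum_le:
  fixes B :: "nat set" and q :: real and \<delta> :: "nat \<Rightarrow> real"
  assumes "finite B" and q: "q > 1" and M: "M \<ge> 2" "M \<le> q ^ p"
    and pos: "\<And>n. \<delta> n > 0" and anti: "\<And>m n. m \<le> n \<Longrightarrow> \<delta> n \<le> \<delta> m"
    and half: "\<And>n. n \<ge> 1 \<Longrightarrow> \<delta> (M * n) \<le> \<delta> n / 2"
    and k: "k \<ge> 1" "\<And>n. n \<in> B \<Longrightarrow> k \<le> n"
    and gap: "\<And>n m. \<lbrakk>n \<in> B; m \<in> B; n < m\<rbrakk> \<Longrightarrow> q * n \<le> m"
  shows "sum \<delta> B \<le> 2 * real p * \<delta> k"
  using k gap \<open>finite B\<close>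
\<comment> \<open>The measure drops because the start moves from \<open>k\<close> to
  \<open>M * k > k\<close>. \<open>Max\<close> is unspecified on the empty set, so empty sets are
  treated separately.\<close>
proof (induction "Suc (Max B) - k" arbitrary: B k rule: less_induct)
  case less
  show ?case
  proof (cases "B = {}")
    case True
    then show ?thesis using pos[of k] by simp
  next
    case False
    define B1 where "B1 = {n \<in> B. n < M * k}"
    define B2 where "B2 = {n \<in> B. n \<ge> M * k}"
    have B: "B = B1 \<union> B2" "B1 \<inter> B2 = {}" "finite B1" "finite B2"
      using less.prems(4) by (auto simp: B1_def B2_def)
    have "card B1 \<le> p"
    proof (rule lacunary_card[OF \<open>finite B1\<close> q])
      fix n assume "n \<in> B1"
      then have "real n < M * k" by (simp add: B1_def del: of_nat_mult add: of_nat_mult[symmetric])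
      also have "\<dots> \<le> q ^ p * k" using M by (simp add: mult_right_mono)
      finally show "real n < q ^ p * k" .
    qed (use less.prems in \<open>auto simp: B1_def\<close>)
    have "sum \<delta> B1 \<le> card B1 * \<delta> k"
      using less.prems(2) by (intro sum_bounded_above) (auto simp: B1_def intro: anti)
    also have "\<dots> \<le> real p * \<delta> k"
      using \<open>card B1 \<le> p\<close> pos[of k] by (intro mult_right_mono) auto
    finally have 1: "sum \<delta> B1 \<le> real p * \<delta> k" .
    have 2: "sum \<delta> B2 \<le> real p * \<delta> k"
    proof (cases "B2 = {}")
      case True
      then show ?thesis using pos[of k] by simp
    next
      case False
      have "Max B2 \<le> Max B" using B False by (intro Max_mono) auto
      moreover have "k < M * k" using M less.prems(1) by simp
      moreover have "k \<le> Max B" using less.prems(2,4) \<open>B \<noteq> {}\<close> by simp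
      ultimately have "Suc (Max B2) - M * k < Suc (Max B) - k" by linarith
      then have "sum \<delta> B2 \<le> 2 * real p * \<delta> (M * k)"
        by (rule less.hyps) (use less.prems M in \<open>auto simp: B2_def\<close>)
      also have "\<dots> \<le> 2 * real p * (\<delta> k / 2)"
        using half[OF less.prems(1)] by (intro mult_left_mono) auto
      finally show ?thesis by simp
    qed
    show ?thesis using 1 2 B by (simp add: sum.union_disjoint)
  qed
qed

text \<open>
  A right special prefix is also a suffix of every longer right special prefix, because right
  special words are closed under suffixes and determined by their length. Repulsiveness thus
  forces the lengths of the right special prefixes to grow geometrically.
\<close>

lemma repulsive_special_weight_sum:
  fixes \<Xi> :: "(nat \<Rightarrow> 'a) set" and \<delta> :: "nat \<Rightarrow> real"
  assumes "repulsive \<Xi>" and uniq: "\<forall>n\<ge>1. \<exists>!w. length w = n \<and> right_special \<Xi> w"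
    and pos: "\<And>n. \<delta> n > 0" and anti: "\<And>m n. m \<le> n \<Longrightarrow> \<delta> n \<le> \<delta> m"
    and lim: "\<delta> \<longlonglongrightarrow> 0" and "c > 0"
    and mult: "\<And>m n. \<lbrakk>n \<ge> 1; m \<ge> 1\<rbrakk> \<Longrightarrow> \<delta> (n * m) \<le> c * \<delta> n * \<delta> m"
  obtains C where "C > 0"
    and "\<And>\<xi> k N. \<xi> \<in> \<Xi> \<Longrightarrow> (\<Sum>n=k..<N. special_weight \<Xi> \<delta> \<xi> n) \<le> C * \<delta> k"
proof -
  obtain l :: real where l: "l > 0"
    "\<And>w W. \<lbrakk>w \<in> language \<Xi>; W \<in> language \<Xi>; length w \<ge> 1; w \<noteq> W; prefix w W; suffix w W\<rbrakk>
      \<Longrightarrow> (1 + l) * length w \<le> length W"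
    using repulsiveE[OF \<open>repulsive \<Xi>\<close>] by metis
  have "eventually (\<lambda>n. \<delta> n < 1 / (2 * c)) sequentially"
    using lim \<open>c > 0\<close> by (intro order_tendstoD) auto
  then have "eventually (\<lambda>n. \<delta> n < 1 / (2 * c) \<and> n \<ge> 2) sequentially"
    using eventually_ge_at_top by (rule eventually_conj)
  then obtain M where M: "\<delta> M < 1 / (2 * c)" "M \<ge> 2"
    using eventually_happens'[OF sequentially_bot] by blast
  have half: "\<delta> (M * n) \<le> \<delta> n / 2" if "n \<ge> 1" for n
  proof -
    have "\<delta> (M * n) \<le> c * \<delta> M * \<delta> n" using mult that M by simp
    also have "\<dots> \<le> 1 / 2 * \<delta> n"
      using M \<open>c > 0\<close> pos[of n] by (intro mult_right_mono) (auto simp: field_simps)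
    finally show ?thesis by simp
  qed
  \<comment> \<open>Between \<open>k\<close> and \<open>M * k\<close> there is room for at most
    \<open>p\<close> lengths with ratio \<open>1 + l\<close>.\<close>
  obtain p where p: "real M < (1 + l) ^ p"
    using real_arch_pow[of "1 + l" "real M"] \<open>l > 0\<close> by auto
  have main: "(\<Sum>n=k..<N. special_weight \<Xi> \<delta> \<xi> n) \<le> 2 * real p * \<delta> k" if "\<xi> \<in> \<Xi>" "k \<ge> 1" for \<xi> k N
  proof -
    define B where "B = {n \<in> {k..<N}. right_special \<Xi> (subword \<xi> 0 n)}"
    have "sum \<delta> B \<le> 2 * real p * \<delta> k"
    proof (rule lacunary_sum_le[where q = "1 + l" and M = M])
      fix n m assume nm: "n \<in> B" "m \<in> B" "n < m"
      let ?v = "drop (m - n) (subword \<xi> 0 m)"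
      have "right_special \<Xi> (subword \<xi> 0 m)" using nm by (simp add: B_def)
      then have "right_special \<Xi> ?v" using suffix_drop by (rule right_special_suffix)
      moreover have "length ?v = n" using nm by simp
      ultimately have "?v = subword \<xi> 0 n"
        using uniq[rule_format, of n] nm \<open>k \<ge> 1\<close> by (auto simp: B_def)
      then have "suffix (subword \<xi> 0 n) (subword \<xi> 0 m)"
        using suffix_drop by metis
      moreover have "prefix (subword \<xi> 0 n) (subword \<xi> 0 m)"
        using take_is_prefix[of n "subword \<xi> 0 m"] nm by (simp add: take_subword)
      moreover have "subword \<xi> 0 n \<noteq> subword \<xi> 0 m"
        using nm by (metis length_subword nat_neq_iff)
      ultimately have "(1 + l) * length (subword \<xi> 0 n) \<le> length (subword \<xi> 0 m)"
        using nm \<open>k \<ge> 1\<close> \<open>\<xi> \<in> \<Xi>\<close> by (intro l) (auto simp: B_def subword_in_language)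
      then show "(1 + l) * n \<le> m" by simp
    qed (use l M p pos anti half that in \<open>auto simp: B_def\<close>)
    moreover have "sum \<delta> B = (\<Sum>n=k..<N. special_weight \<Xi> \<delta> \<xi> n)"
      unfolding B_def special_weight_def by (rule sum.inter_filter) simp
    ultimately show ?thesis by simp
  qed
  show thesis
  proof (rule that)
    \<comment> \<open>The extra \<open>1\<close> pays for the empty prefix when
      \<open>k = 0\<close>, a case that \<open>main\<close> excludes.\<close>
    show "0 < 1 + 2 * real p" by simp
    fix \<xi> k N assume "\<xi> \<in> \<Xi>"
    let ?S = "\<lambda>k. \<Sum>n=k..<N. special_weight \<Xi> \<delta> \<xi> n"
    show "?S k \<le> (1 + 2 * real p) * \<delta> k"
    proof (cases "k = 0")
      case False
      then show ?thesis
        using main[OF \<open>\<xi> \<in> \<Xi>\<close>, of k N] pos[of k] by (simp add: algebra_simps)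
    next
      case True
      have "?S 0 \<le> \<delta> 0 + ?S 1"
        using pos[of 0] by (cases "N = 0") (auto simp: special_weight_def sum.atLeast_Suc_lessThan)
      also have "\<dots> \<le> \<delta> 0 + 2 * real p * \<delta> 1" using main[OF \<open>\<xi> \<in> \<Xi>\<close>, of 1 N] by simp
      also have "\<dots> \<le> \<delta> 0 + 2 * real p * \<delta> 0"
        using anti[of 0 1] by (intro add_left_mono mult_left_mono) auto
      finally show ?thesis using True by (simp add: algebra_simps)
    qed
  qed
qed

section \<open>Subshifts with high powers\<close>

lemma not_repulsiveE:
  assumes "\<not> repulsive \<Xi>" and "\<epsilon> > 0"
  obtains w W where "w \<in> language \<Xi>" "W \<in> language \<Xi>" "length w \<ge> 1" "w \<noteq> W"
    "prefix w W" "suffix w W" "real (length W) - real (length w) < \<epsilon> * real (length w)"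
proof -
  have "repulsion_index \<Xi> < ereal \<epsilon>"
    using assms by (simp add: repulsive_def not_less le_less_trans)
  then obtain w W where w: "w \<in> language \<Xi>" "W \<in> language \<Xi>" "length w \<ge> 1" "w \<noteq> W"
    "prefix w W" "suffix w W"
    and "ereal ((real (length W) - real (length w)) / real (length w)) < ereal \<epsilon>"
    unfolding repulsion_index_def Inf_less_iff by blast
  then have "(real (length W) - real (length w)) / real (length w) < \<epsilon>" by simp
  moreover have "real (length w) > 0" using w(3) by linarith
  ultimately show thesis using that[OF w] by (simp only: pos_divide_less_eq)
qed

text \<open>By repetitivity every extension \<open>w @ [a]\<close> occurs in \<open>\<xi>\<close>.
  If \<open>\<xi>\<close> had period \<open>p = length w\<close>, then \<open>a\<close> would have
  to be the first letter of \<open>w\<close>, leaving no second extension.\<close>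

lemma repetitive_not_periodic:
  assumes "repetitive \<Xi>" and "\<xi> \<in> \<Xi>" and "right_special \<Xi> w" and "length w = p" "p \<ge> 1"
  shows "\<exists>i. \<xi> (i + p) \<noteq> \<xi> i"
proof (rule ccontr)
  assume "\<nexists>i. \<xi> (i + p) \<noteq> \<xi> i"
  then have per: "\<xi> (i + p) = \<xi> i" for i by simp
  obtain N where N: "\<And>W v. \<lbrakk>W \<in> language \<Xi>; v \<in> language \<Xi>; length W = N; length v = Suc p\<rbrakk> \<Longrightarrow> sublist v W"
    using assms(1) unfolding repetitive_def by metis
  have "a = w ! 0" if "w @ [a] \<in> language \<Xi>" for a
  proof -
    have "sublist (w @ [a]) (subword \<xi> 0 N)"
      using N that assms(2,4) by (simp add: subword_in_language)
    then obtain xs ys where "subword \<xi> 0 N = xs @ (w @ [a]) @ ys"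
      by (auto simp: sublist_def)
    then have eq: "w @ [a] = subword \<xi> (length xs) (Suc p)"
      using subword_infix[of \<xi> 0 N xs "w @ [a]" ys] assms(4) by simp
    have "a = (w @ [a]) ! p" "w ! 0 = (w @ [a]) ! 0"
      using assms(4,5) by (auto simp: nth_append)
    then show ?thesis unfolding eq by (simp add: per)
  qed
  then show False using assms(3) unfolding right_special_def by metis
qed

text \<open>Both indices read the same letter of \<open>w\<close>, once in its occurrence as a
  suffix and once as a prefix.\<close>

lemma prefix_suffix_periodic:
  assumes "prefix w W" "suffix w W" "i + (length W - length w) < length W"
  shows "W ! (i + (length W - length w)) = W ! i"
proof -
  obtain ys where ys: "W = w @ ys" using assms(1) by (auto simp: prefix_def)
  obtain xs where "W = xs @ w" using assms(2) by (auto simp: suffix_def)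
  note W = ys this
  have xs: "length xs = length W - length w" using W(2) by simp
  have i: "i < length w" using assms xs W by auto
  have "(xs @ w) ! (i + length xs) = (w @ ys) ! i"
    using i by (simp add: nth_append)
  then show ?thesis using W xs by metis
qed

text \<open>
  The word \<open>W\<close> has the period \<open>p = |W| - |w|\<close>. Continue it to the right until the period breaks,
  say at position \<open>L\<close>. The prefix of length \<open>L - p\<close> then occurs at \<open>0\<close> and at \<open>p\<close> with different
  continuations, and by periodicity its suffixes of length \<open>L - p - i p\<close> are prefixes as well.
\<close>

lemma not_repulsive_right_special_prefixes:
  fixes \<Xi> :: "(nat \<Rightarrow> 'a::finite) set" and j :: nat
  assumes sub: "is_subshift \<Xi>" and "repetitive \<Xi>"
    and rs: "\<And>n. n \<ge> 1 \<Longrightarrow> \<exists>w. length w = n \<and> right_special \<Xi> w"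
    and "\<not> repulsive \<Xi>" and "j \<ge> 1"
  obtains \<xi> k p where "\<xi> \<in> \<Xi>" "k \<ge> 1" "p \<ge> 1" "j * p \<le> k"
    "\<And>i. i \<le> j \<Longrightarrow> right_special \<Xi> (subword \<xi> 0 (k + i * p))"
proof -
  obtain w W where w: "w \<in> language \<Xi>" "W \<in> language \<Xi>" "length w \<ge> 1" "w \<noteq> W"
    "prefix w W" "suffix w W"
    \<comment> \<open>The value \<open>1 / (2 * j)\<close> gives
      \<open>2 * j * p < length w\<close>, so that \<open>j\<close> periods can be removed from the
      right special prefix and at least \<open>j * p\<close> letters remain.\<close>
    and small: "real (length W) - real (length w) < 1 / (2 * j) * real (length w)"
    using not_repulsiveE[OF \<open>\<not> repulsive \<Xi>\<close>, of "1 / (2 * j)"] \<open>j \<ge> 1\<close> by auto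
  define p where "p = length W - length w"
  have lw: "length w < length W"
    using w(4,5) by (auto simp: prefix_def)
  then have "p \<ge> 1" by (simp add: p_def)
  have "real (2 * j * p) < real (length w)"
    using small lw \<open>j \<ge> 1\<close> by (simp add: p_def of_nat_diff field_simps)
  then have jp: "2 * j * p < length w" by linarith
  obtain \<xi> where \<xi>: "\<xi> \<in> \<Xi>" "subword \<xi> 0 (length W) = W"
    using language_prefixE[OF sub w(2)] .
  have nthW: "W ! i = \<xi> i" if "i < length W" for i
    using that nth_subword[of i "length W" \<xi> 0] \<xi>(2) by simp
  \<comment> \<open>The period breaks at position \<open>Q + p\<close>, so \<open>Q\<close> is the
    length of the longest right special prefix constructed here.\<close>
  define Q where "Q = (LEAST i. \<xi> (i + p) \<noteq> \<xi> i)"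
  have "\<exists>i. \<xi> (i + p) \<noteq> \<xi> i"
    using rs[OF \<open>p \<ge> 1\<close>] repetitive_not_periodic[OF \<open>repetitive \<Xi>\<close> \<xi>(1) _ _ \<open>p \<ge> 1\<close>] by blast
  then have Q: "\<xi> (Q + p) \<noteq> \<xi> Q" unfolding Q_def by (rule LeastI_ex)
  have per: "\<xi> (i + p) = \<xi> i" if "i < Q" for i
    using not_less_Least that unfolding Q_def by blast
  \<comment> \<open>An earlier break would lie inside \<open>W\<close>, which has period
    \<open>p\<close>.\<close>
  have "length w \<le> Q"
  proof (rule ccontr)
    assume "\<not> length w \<le> Q"
    then have "Q + p < length W" using lw by (simp add: p_def)
    then show False
      using Q prefix_suffix_periodic[OF w(5,6), of Q] nthW by (simp add: p_def)
  qed
  have perj: "\<xi> (n + i * p) = \<xi> n" if "n + i * p < Q + p" for n i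
    using that
  proof (induction i)
    case (Suc i)
    then have "\<xi> ((n + i * p) + p) = \<xi> (n + i * p)" by (intro per) simp
    with Suc show ?case by (simp add: algebra_simps)
  qed simp
  have rsQ: "right_special \<Xi> (subword \<xi> 0 Q)"
  proof -
    have "subword \<xi> p Q = subword \<xi> 0 Q"
      by (rule nth_equalityI) (auto simp: per add.commute)
    then have "subword \<xi> 0 Q @ [\<xi> Q] = subword \<xi> 0 (Suc Q)"
      "subword \<xi> 0 Q @ [\<xi> (Q + p)] = subword \<xi> p (Suc Q)"
      by (simp_all add: subword_Suc add.commute)
    then show ?thesis
      unfolding right_special_def using Q subword_in_language[OF \<xi>(1)] by metis
  qed
  show thesis
  proof (rule that[of \<xi> "Q - j * p" p])
    show "Q - j * p \<ge> 1" "j * p \<le> Q - j * p"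
      using jp \<open>length w \<le> Q\<close> by linarith+
    fix i assume "i \<le> j"
    \<comment> \<open>Deleting \<open>t\<close> periods from the front of the prefix of length
      \<open>Q\<close> leaves the prefix of length \<open>k + i * p\<close>, where
      \<open>k = Q - j * p\<close>.\<close>
    define t where "t = j - i"
    have "j * p \<le> Q" using jp \<open>length w \<le> Q\<close> by linarith
    have tp: "t * p \<le> j * p" by (simp add: t_def)
    have "j * p = t * p + i * p"
      using \<open>i \<le> j\<close> by (simp add: t_def add_mult_distrib[symmetric])
    then have idx: "Q - j * p + i * p = Q - t * p"
      using \<open>j * p \<le> Q\<close> by linarith
    have "drop (t * p) (subword \<xi> 0 Q) = subword \<xi> 0 (Q - t * p)"
    proof (rule nth_equalityI)
      fix n assume "n < length (drop (t * p) (subword \<xi> 0 Q))"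
      then show "drop (t * p) (subword \<xi> 0 Q) ! n = subword \<xi> 0 (Q - t * p) ! n"
        using perj[of n t] by (simp add: add.commute)
    qed simp
    then show "right_special \<Xi> (subword \<xi> 0 (Q - j * p + i * p))"
      using right_special_suffix[OF rsQ] suffix_drop idx by metis
  qed (use \<xi> \<open>p \<ge> 1\<close> in auto)
qed

lemma special_weight_sum_ge:
  assumes pos: "\<And>n. \<delta> n > 0" and anti: "\<And>m n. m \<le> n \<Longrightarrow> \<delta> n \<le> \<delta> m"
    and "p \<ge> 1" "j * p \<le> k"
    and rs: "\<And>i. i \<le> j \<Longrightarrow> right_special \<Xi> (subword \<xi> 0 (k + i * p))"
  shows "real (Suc j) * \<delta> (2 * k) \<le> (\<Sum>n=k..2 * k. special_weight \<Xi> \<delta> \<xi> n)"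
proof -
  have inj: "inj_on (\<lambda>i. k + i * p) {..j}" using \<open>p \<ge> 1\<close> by (auto simp: inj_on_def)
  have le: "i * p \<le> k" if "i \<le> j" for i
    using mult_le_mono1[OF that, of p] \<open>j * p \<le> k\<close> by linarith
  have "real (Suc j) * \<delta> (2 * k) = (\<Sum>i\<le>j. \<delta> (2 * k))" by simp
  also have "\<dots> \<le> (\<Sum>i\<le>j. special_weight \<Xi> \<delta> \<xi> (k + i * p))"
    using rs le by (intro sum_mono) (auto simp: special_weight_def intro!: anti)
  also have "\<dots> = sum (special_weight \<Xi> \<delta> \<xi>) ((\<lambda>i. k + i * p) ` {..j})"
    using inj by (simp add: sum.reindex)
  also have "\<dots> \<le> (\<Sum>n=k..2 * k. special_weight \<Xi> \<delta> \<xi> n)"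
    using le pos by (intro sum_mono2) (auto simp: special_weight_def less_imp_le)
  finally show ?thesis .
qed

theorem theorem4p12:
  fixes \<Xi> :: "(nat \<Rightarrow> 'a::finite) set" and \<delta> :: "nat \<Rightarrow> real"
  assumes "is_subshift \<Xi>"
    and "repetitive \<Xi>"
    and "\<forall>n\<ge>1. \<exists>!w. length w = n \<and> right_special \<Xi> w"
    and "\<forall>n. \<delta> n > 0"
    and "\<forall>m n. m < n \<longrightarrow> \<delta> n < \<delta> m"
    and "\<delta> \<longlonglongrightarrow> 0"
    and "\<exists>c1>0. \<forall>n\<ge>1. c1 * \<delta> n \<le> \<delta> (2 * n)"
    and "\<exists>c2>0. \<forall>n\<ge>1. \<forall>m\<ge>1. \<delta> (n * m) \<le> c2 * \<delta> n * \<delta> m"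
  shows "repulsive \<Xi> \<longleftrightarrow>
    lipschitz_equivalent \<Xi> (upper_spectral_dist \<Xi> \<delta>) (shift_dist \<delta>)"
proof
  note sub = \<open>is_subshift \<Xi>\<close>
  have pos: "\<delta> n > 0" for n using assms(4) by simp
  have anti: "\<delta> n \<le> \<delta> m" if "m \<le> n" for m n
    using assms(5) that by (cases "m = n") (auto simp: less_imp_le)
  {
    assume "repulsive \<Xi>"
    obtain c2 where "c2 > 0" "\<forall>n\<ge>1. \<forall>m\<ge>1. \<delta> (n * m) \<le> c2 * \<delta> n * \<delta> m"
      using assms(8) by blast
    then obtain C where C: "C > 0"
      "\<And>\<xi> k N. \<xi> \<in> \<Xi> \<Longrightarrow> (\<Sum>n=k..<N. special_weight \<Xi> \<delta> \<xi> n) \<le> C * \<delta> k"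
      using repulsive_special_weight_sum[where \<delta> = \<delta>, OF \<open>repulsive \<Xi>\<close> assms(3) pos anti assms(6)] by metis
    \<comment> \<open>Both sequences contribute \<open>C\<close> to the upper bound; the
      \<open>1\<close> ensures \<open>inverse K \<le> 1\<close> for the lower one.\<close>
    define K where "K = 2 * C + 1"
    have "ennreal (inverse K * shift_dist \<delta> x y) \<le> upper_spectral_dist \<Xi> \<delta> x y \<and>
        upper_spectral_dist \<Xi> \<delta> x y \<le> ennreal (K * shift_dist \<delta> x y)"
      if xy: "x \<in> \<Xi>" "y \<in> \<Xi>" for x y
    proof (cases "x = y")
      case True
      have "upper_spectral_dist \<Xi> \<delta> x x \<le> 0"
        unfolding upper_spectral_dist_def spectral_dist_def by (intro SUP_least) simp
      then show ?thesis using True by (simp add: shift_dist_def)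
    next
      case False
      then obtain k where k: "shift_dist \<delta> x y = \<delta> k" "\<And>i. i < k \<Longrightarrow> x i = y i" "x k \<noteq> y k"
        using shift_dist_neq by metis
      have "subword x 0 k = subword y 0 k" using k(2) by (simp add: subword_eq_iff)
      then have "subword x 0 k @ [x k] = subword x 0 (Suc k)" "subword x 0 k @ [y k] = subword y 0 (Suc k)"
        by (simp_all add: subword_Suc)
      then have "right_special \<Xi> (subword x 0 k)"
        unfolding right_special_def using k(3) xy subword_in_language by metis
      \<comment> \<open>The longest common prefix is right special, so the single summand at
        \<open>k\<close> already gives the lower bound.\<close>
      then have "ennreal (\<delta> k) \<le> upper_spectral_dist \<Xi> \<delta> x y"
        using upper_spectral_dist_ge[where \<delta> = \<delta> and N = k, OF sub pos xy(1) k(2,3)]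
        by (simp add: special_weight_def)
      moreover have "inverse K * \<delta> k \<le> \<delta> k"
        using C(1) pos[of k] by (simp add: K_def field_simps)
      moreover have "upper_spectral_dist \<Xi> \<delta> x y \<le> ennreal (C * \<delta> k + C * \<delta> k)"
        using sub pos xy k(2) C(2)[OF xy(1)] C(2)[OF xy(2)] by (rule upper_spectral_dist_le)
      moreover have "C * \<delta> k + C * \<delta> k \<le> K * \<delta> k"
        using pos[of k] by (simp add: K_def algebra_simps)
      ultimately show ?thesis
        unfolding k(1) by (meson ennreal_leI order_trans)
    qed
    then show "lipschitz_equivalent \<Xi> (upper_spectral_dist \<Xi> \<delta>) (shift_dist \<delta>)"
      unfolding lipschitz_equivalent_def using C(1) by (intro exI[of _ K]) (simp add: K_def)
  }
  {
    assume "lipschitz_equivalent \<Xi> (upper_spectral_dist \<Xi> \<delta>) (shift_dist \<delta>)"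
    then obtain c where c: "c > 0"
      "\<And>x y. \<lbrakk>x \<in> \<Xi>; y \<in> \<Xi>\<rbrakk> \<Longrightarrow> upper_spectral_dist \<Xi> \<delta> x y \<le> ennreal (c * shift_dist \<delta> x y)"
      unfolding lipschitz_equivalent_def by blast
    obtain c1 where c1: "c1 > 0" "\<And>n. n \<ge> 1 \<Longrightarrow> c1 * \<delta> n \<le> \<delta> (2 * n)"
      using assms(7) by blast
    show "repulsive \<Xi>"
    proof (rule ccontr)
      assume nr: "\<not> repulsive \<Xi>"
      \<comment> \<open>With this \<open>j\<close>, the \<open>j + 1\<close> right special prefixes
        contribute at least \<open>(j + 1) * c1 * \<delta> k\<close>, which exceeds
        \<open>c * \<delta> k\<close>.\<close>
      obtain j :: nat where j: "real j > c / c1" using reals_Archimedean2 by blast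
      then have "j \<ge> 1" using c(1) c1(1) by (cases j) (auto simp: field_simps)
      then obtain \<xi> k p where \<xi>: "\<xi> \<in> \<Xi>" "k \<ge> 1" "p \<ge> 1" "j * p \<le> k"
        and rs: "\<And>i. i \<le> j \<Longrightarrow> right_special \<Xi> (subword \<xi> 0 (k + i * p))"
        using not_repulsive_right_special_prefixes[OF sub assms(2) _ nr] assms(3) by metis
      have "right_special \<Xi> (subword \<xi> 0 k)" using rs[of 0] by simp
      \<comment> \<open>Leaving \<open>\<xi>\<close> at its right special prefix of length
        \<open>k\<close> produces \<open>\<eta>\<close> at distance exactly
        \<open>\<delta> k\<close>.\<close>
      then obtain b where b: "b \<noteq> \<xi> k" "subword \<xi> 0 k @ [b] \<in> language \<Xi>"
        unfolding right_special_def by metis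
      then obtain \<eta> where \<eta>: "\<eta> \<in> \<Xi>" "subword \<eta> 0 (Suc k) = subword \<xi> 0 k @ [b]"
        using language_prefixE[OF sub b(2)] by auto
      then have eq: "subword \<xi> 0 k = subword \<eta> 0 k" and ne: "\<xi> k \<noteq> \<eta> k"
        using b(1) by (auto simp: subword_Suc)
      then have agree: "\<xi> i = \<eta> i" if "i < k" for i
        using that by (simp add: subword_eq_iff)
      have "ennreal (\<Sum>n=k..2 * k. special_weight \<Xi> \<delta> \<xi> n) \<le> upper_spectral_dist \<Xi> \<delta> \<xi> \<eta>"
        using sub pos \<xi>(1) agree ne by (rule upper_spectral_dist_ge)
      also have "\<dots> \<le> ennreal (c * \<delta> k)"
        using c(2)[OF \<xi>(1) \<eta>(1)] shift_dist_eq[of k \<xi> \<eta> \<delta>, OF agree ne] by simp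
      finally have "(\<Sum>n=k..2 * k. special_weight \<Xi> \<delta> \<xi> n) \<le> c * \<delta> k"
        using c(1) pos[of k] by (simp add: ennreal_le_iff less_imp_le)
      moreover have "real (Suc j) * (c1 * \<delta> k) \<le> real (Suc j) * \<delta> (2 * k)"
        using c1(2)[OF \<xi>(2)] by (intro mult_left_mono) auto
      ultimately have "real (Suc j) * (c1 * \<delta> k) \<le> c * \<delta> k"
        using special_weight_sum_ge[of \<delta> p j k \<Xi> \<xi>, OF pos anti \<xi>(3,4) rs] by linarith
      then have "real (Suc j) * c1 * \<delta> k \<le> c * \<delta> k" by (simp only: mult.assoc)
      then have "real (Suc j) * c1 \<le> c" using pos[of k] by (simp only: mult_le_cancel_right_pos)
      then show False using j c1(1) by (simp add: field_simps)
    qed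
  }
qed

end
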